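(* Let $E$ be a Banach lattice and $Y$ a real Banach space. Let $(T_n)$ be a sequence of limitedly Mwc operators from $E$ to $Y$ that converges in operator norm to a bounded linear operator $T:E\to Y$. Then $T$ is limitedly Mwc.
   Context: A bounded linear operator $T$ from a Banach lattice $E$ to a Banach space $Y$ is limitedly Mwc (l-Mwc) if $Tx_n\to 0$ weakly for every disjoint norm-bounded sequence $(x_n)$ in $E$. *)

theory Defs
  imports "HOL-Analysis.Analysis" "HOL-Library.Lattice_Algebras"
begin

(* The modulus is \<bar>x\<bar> = sup x (- x), by lattice_ab_group_add_abs.abs_lattice.
   The superclasses supply the Riesz space and the complete norm; the added axiom
   says that the norm is a lattice norm. *)
class banach_lattice = banach + ordered_real_vector + lattice_ab_group_add_abs +
  assumes norm_lattice_mono: "\<bar>x\<bar> \<le> \<bar>y\<bar> \<Longrightarrow> norm x \<le> norm y"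

instance real :: banach_lattice
  by standard simp

definition disjoint_seq :: "(nat \<Rightarrow> 'a::banach_lattice) \<Rightarrow> bool"
  where "disjoint_seq x \<longleftrightarrow> (\<forall>m n. m \<noteq> n \<longrightarrow> inf \<bar>x m\<bar> \<bar>x n\<bar> = 0)"

definition weakly_converges :: "(nat \<Rightarrow> 'b::real_normed_vector) \<Rightarrow> 'b \<Rightarrow> bool"
  where "weakly_converges y l \<longleftrightarrow> (\<forall>f :: 'b \<Rightarrow>\<^sub>L real. (\<lambda>n. f (y n)) \<longlonglongrightarrow> f l)"

definition limitedly_Mwc :: "('a::banach_lattice \<Rightarrow>\<^sub>L 'b::banach) \<Rightarrow> bool"
  where "limitedly_Mwc T \<longleftrightarrow>
    (\<forall>x. disjoint_seq x \<and> Bseq x \<longrightarrow> weakly_converges (\<lambda>n. T (x n)) 0)"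

end

theory Submission
  imports Defs
begin

text \<open>Fix a disjoint bounded sequence \<open>x\<close> and a functional \<open>f\<close>. In
  the double sequence \<open>f (T k (x n))\<close>, each row \<open>k\<close> tends to 0 in
  \<open>n\<close>, because \<open>T k\<close> is limitedly Mwc. By
  \<open>uniform_limit_blinfun\<close>, the rows converge to \<open>f (S (x n))\<close> uniformly in
  \<open>n\<close>. The Moore-Osgood interchange of limits then gives the claim.\<close>

text \<open>On a bounded set, norm convergence of operators is uniform convergence, so the limit
  along the disjoint sequence may be interchanged with the limit in operator norm.\<close>

lemma uniform_limit_blinfun:
  fixes T :: "'a \<Rightarrow> 'b::real_normed_vector \<Rightarrow>\<^sub>L 'c::real_normed_vector"
  assumes "(T \<longlongrightarrow> S) F" and "Bseq x"
  shows "uniform_limit UNIV (\<lambda>k n. T k (x n)) (\<lambda>n. S (x n)) F"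
proof (rule uniform_limitI)
  fix e :: real
  assume "e > 0"
  from \<open>Bseq x\<close> obtain B where "B > 0" and B: "\<And>n. norm (x n) \<le> B"
    by (auto elim: BseqE)
  \<comment> \<open>Dividing by the bound \<open>B\<close> of the sequence makes the choice of
    \<open>k\<close> independent of \<open>n\<close>.\<close>
  have "\<forall>\<^sub>F k in F. dist (T k) S < e / B"
    using assms(1) \<open>e > 0\<close> \<open>B > 0\<close> by (intro tendstoD) auto
  then show "\<forall>\<^sub>F k in F. \<forall>n\<in>UNIV. dist (T k (x n)) (S (x n)) < e"
  proof eventually_elim
    case (elim k)
    show ?case
    proof
      fix n
      have "dist (T k (x n)) (S (x n)) \<le> norm (T k - S) * norm (x n)"
        using norm_blinfun[of "T k - S" "x n"] by (simp add: dist_norm blinfun.diff_left)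
      also have "\<dots> \<le> norm (T k - S) * B"
        by (intro mult_left_mono B) simp
      also have "\<dots> < e"
        using elim \<open>B > 0\<close> by (simp add: dist_norm field_simps)
      finally show "dist (T k (x n)) (S (x n)) < e" .
    qed
  qed
qed

theorem proposition2p18:
  fixes T :: "nat \<Rightarrow> 'e::banach_lattice \<Rightarrow>\<^sub>L 'y::banach"
    and S :: "'e \<Rightarrow>\<^sub>L 'y"
  assumes "\<And>n. limitedly_Mwc (T n)"
    and "T \<longlonglongrightarrow> S"
  shows "limitedly_Mwc S"
  unfolding limitedly_Mwc_def weakly_converges_def
proof (intro allI impI)
  fix x :: "nat \<Rightarrow> 'e" and f :: "'y \<Rightarrow>\<^sub>L real"
  assume x: "disjoint_seq x \<and> Bseq x"
  have lim: "(\<lambda>n. f (T k (x n))) \<longlonglongrightarrow> f 0" for k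
    using assms(1)[of k] x by (auto simp: limitedly_Mwc_def weakly_converges_def)
  have "uniform_limit UNIV (\<lambda>k n. f (T k (x n))) (\<lambda>n. f (S (x n))) sequentially"
    using x
    \<comment> \<open>A bounded linear \<open>f\<close> preserves uniform limits; only the
      boundedness of \<open>x\<close> enters here.\<close>
    by (intro bounded_linear.uniform_limit[OF blinfun.bounded_linear_right]
          uniform_limit_blinfun[OF assms(2)]) simp
  then show "(\<lambda>n. f (S (x n))) \<longlonglongrightarrow> f 0"
    \<comment> \<open>All row limits equal \<open>f 0\<close>, so the outer limit in
      \<open>k\<close> is that of a constant sequence.\<close>
    by (rule swap_uniform_limit'[OF always_eventually[OF allI[OF lim]] tendsto_const]) simp_all
qed

end
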